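(* $\mathrm{ex}_<(n,C_4^{1243})=\Theta(n^{3/2})$; that is, there exist constants $c_1,c_2>0$ and $n_0$ such that $c_1n^{3/2}\le \mathrm{ex}_<(n,C_4^{1243})\le c_2n^{3/2}$ for all integers $n\ge n_0$.
   Context: An edge-ordered graph is a finite simple graph $G=(V,E)$ with a linear order on its edge set $E$. An isomorphism between edge-ordered graphs must respect the edge-order. A subgraph of an edge-ordered graph is itself an edge-ordered graph with the induced edge-order. An edge-ordered graph $G$ contains another edge-ordered graph $H$ if $H$ is isomorphic to a subgraph of $G$; otherwise $G$ avoids $H$. For a positive integer $n$ and an edge-ordered graph $H$, $\mathrm{ex}_<(n,H)$ is the maximal number of edges in an edge-ordered graph on $n$ vertices that avoids $H$. $C_4^{1243}$ denotes the four-cycle $abcd$ (with edges $ab,bc,cd,da$) whose edges are ordered as $ab<bc<da<cd$. *)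

theory Defs
  imports Complex_Main
begin

text \<open>The order is a reflexive relation on the edge set, as in \<^const>\<open>linear_order_on\<close>:
  a pair (e, f) in it means that e is at most f.\<close>

record 'a eo_graph =
  verts :: "'a set"
  edges :: "'a set set"
  eord :: "'a set rel"

definition edge_ordered_graph :: "'a eo_graph \<Rightarrow> bool" where
  "edge_ordered_graph G \<longleftrightarrow>
     finite (verts G) \<and>
     (\<forall>e\<in>edges G. e \<subseteq> verts G \<and> card e = 2) \<and>
     linear_order_on (edges G) (eord G)"

definition eo_isomorphic :: "'a eo_graph \<Rightarrow> 'b eo_graph \<Rightarrow> bool" where
  "eo_isomorphic G H \<longleftrightarrow>
     (\<exists>f. bij_betw f (verts G) (verts H) \<and>
          (\<lambda>e. f ` e) ` edges G = edges H \<and>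
          (\<forall>e\<in>edges G. \<forall>e'\<in>edges G. (e, e') \<in> eord G \<longleftrightarrow> (f ` e, f ` e') \<in> eord H))"

definition eo_subgraph :: "'a eo_graph \<Rightarrow> 'a eo_graph \<Rightarrow> bool" where
  "eo_subgraph G' G \<longleftrightarrow>
     edge_ordered_graph G' \<and>
     verts G' \<subseteq> verts G \<and> edges G' \<subseteq> edges G \<and>
     eord G' = Restr (eord G) (edges G')"

definition eo_contains :: "'a eo_graph \<Rightarrow> 'b eo_graph \<Rightarrow> bool" where
  "eo_contains G H \<longleftrightarrow> (\<exists>G'. eo_subgraph G' G \<and> eo_isomorphic H G')"

abbreviation eo_avoids :: "'a eo_graph \<Rightarrow> 'b eo_graph \<Rightarrow> bool" where
  "eo_avoids G H \<equiv> \<not> eo_contains G H"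

text \<open>Vertices are natural numbers without loss of generality: every finite graph is isomorphic
  to one of this form. The maximum exists whenever H has an edge; see below.\<close>

definition ex_eo :: "nat \<Rightarrow> 'b eo_graph \<Rightarrow> nat" where
  "ex_eo n H = Max {card (edges G) | G :: nat eo_graph.
     edge_ordered_graph G \<and> card (verts G) = n \<and> eo_avoids G H}"

definition list_order :: "'a list \<Rightarrow> 'a rel" where
  "list_order xs = {(xs ! i, xs ! j) | i j. i \<le> j \<and> j < length xs}"

text \<open>The vertices a, b, c, d are 0, 1, 2, 3. Around the cycle the edges ab, bc, cd, da have the
  ranks 1, 2, 4, 3, so their increasing order is ab, bc, da, cd.\<close>

definition C4_1243 :: "nat eo_graph" where
  "C4_1243 =
     \<lparr>verts = {0, 1, 2, 3},
      edges = {{0, 1}, {1, 2}, {2, 3}, {3, 0}},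
      eord = list_order [{0, 1}, {1, 2}, {3, 0}, {2, 3}]\<rparr>"

lemma linear_order_on_list_order:
  assumes "distinct xs"
  shows "linear_order_on (set xs) (list_order xs)"
  unfolding linear_order_on_def partial_order_on_def preorder_on_def
proof (intro conjI)
  show "list_order xs \<subseteq> set xs \<times> set xs"
    by (auto simp: list_order_def)
  show "refl_on (set xs) (list_order xs)"
    unfolding list_order_def refl_on_def by (clarsimp simp: in_set_conv_nth) blast
  show "trans (list_order xs)"
  proof (rule transI)
    fix x y z assume "(x, y) \<in> list_order xs" "(y, z) \<in> list_order xs"
    then obtain i j k l where *: "x = xs ! i" "y = xs ! j" "i \<le> j" "j < length xs"
      "y = xs ! k" "z = xs ! l" "k \<le> l" "l < length xs"
      unfolding list_order_def by blast
    then have "j = k" using assms by (simp add: nth_eq_iff_index_eq)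
    with * have "i \<le> l" by simp
    with * show "(x, z) \<in> list_order xs" unfolding list_order_def by blast
  qed
  show "antisym (list_order xs)"
  proof (rule antisymI)
    fix x y assume "(x, y) \<in> list_order xs" "(y, x) \<in> list_order xs"
    then obtain i j k l where *: "x = xs ! i" "y = xs ! j" "i \<le> j" "j < length xs"
      "y = xs ! k" "x = xs ! l" "k \<le> l" "l < length xs"
      unfolding list_order_def by blast
    have "xs ! j = xs ! k" "xs ! i = xs ! l" using * by simp_all
    then have "j = k" "i = l" using * assms by (simp_all add: nth_eq_iff_index_eq)
    with * show "x = y" by simp
  qed
  show "total_on (set xs) (list_order xs)"
  proof (rule total_onI)
    fix x y assume "x \<in> set xs" "y \<in> set xs"
    then obtain i j where "x = xs ! i" "i < length xs" "y = xs ! j" "j < length xs"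
      by (auto simp: in_set_conv_nth)
    then show "(x, y) \<in> list_order xs \<or> (y, x) \<in> list_order xs"
      unfolding list_order_def using nat_le_linear[of i j] by blast
  qed
qed

lemma edge_ordered_graph_C4_1243: "edge_ordered_graph C4_1243"
proof -
  let ?es = "[{0, 1}, {1, 2}, {3, 0}, {2, 3}] :: nat set list"
  have "distinct ?es"
    by (simp add: doubleton_eq_iff)
  from linear_order_on_list_order[OF this]
  have "linear_order_on (set ?es) (list_order ?es)" .
  moreover have "edges C4_1243 = set ?es"
    by (auto simp: C4_1243_def)
  ultimately show ?thesis
    by (auto simp: edge_ordered_graph_def C4_1243_def)
qed

lemma ex_eo_attained:
  fixes H :: "'b eo_graph"
  assumes "edges H \<noteq> {}"
  shows "\<exists>G :: nat eo_graph. edge_ordered_graph G \<and> card (verts G) = n \<and> eo_avoids G H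
           \<and> card (edges G) = ex_eo n H"
    and "edge_ordered_graph (G :: nat eo_graph) \<Longrightarrow> card (verts G) = n \<Longrightarrow> eo_avoids G H
           \<Longrightarrow> card (edges G) \<le> ex_eo n H"
proof -
  let ?S = "{card (edges G) | G :: nat eo_graph.
     edge_ordered_graph G \<and> card (verts G) = n \<and> eo_avoids G H}"
  have "m \<le> 2 ^ n" if m: "m \<in> ?S" for m
  proof -
    from m obtain G :: "nat eo_graph"
      where G: "m = card (edges G)" "edge_ordered_graph G" "card (verts G) = n" by blast
    then have "edges G \<subseteq> Pow (verts G)" "finite (verts G)"
      by (auto simp: edge_ordered_graph_def)
    then have "card (edges G) \<le> card (Pow (verts G))" by (intro card_mono) auto
    with G \<open>finite (verts G)\<close> show ?thesis by (simp add: card_Pow)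
  qed
  then have fin: "finite ?S" by (meson finite_nat_set_iff_bounded_le)
  let ?G = "\<lparr>verts = {..<n}, edges = {}, eord = {}\<rparr>"
  have "edge_ordered_graph ?G"
    by (simp add: edge_ordered_graph_def)
  moreover have "eo_avoids ?G H"
    using assms by (auto simp: eo_contains_def eo_subgraph_def eo_isomorphic_def)
  ultimately have "card (edges ?G) \<in> ?S" by force
  then have "?S \<noteq> {}" by blast
  from Max_in[OF fin this] show "\<exists>G :: nat eo_graph. edge_ordered_graph G \<and> card (verts G) = n
      \<and> eo_avoids G H \<and> card (edges G) = ex_eo n H"
    unfolding ex_eo_def by force
  show "card (edges G) \<le> ex_eo n H"
    if "edge_ordered_graph (G :: nat eo_graph)" "card (verts G) = n" "eo_avoids G H"
    unfolding ex_eo_def using that by (intro Max_ge[OF fin]) blast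
qed

end

theory Submission
  imports Defs "HOL-Analysis.Convex" "HOL-Library.Nat_Bijection" "HOL-Library.Z2"
    "HOL-Algebra.Algebraic_Closure_Type"
begin

text \<open>
  Upper bound. Consider the cherries \<open>u - w - v\<close> with \<open>uw\<close> before \<open>wv\<close>. Avoiding
  \<open>C\<^sub>4\<^sup>1\<^sup>2\<^sup>4\<^sup>3\<close> means exactly that, for every ordered pair \<open>(u, v)\<close>, the time intervals
  \<open>[uw, wv]\<close> of these cherries form a chain under strict nesting. Two nested cherries from
  \<open>u\<close> to \<open>v\<close> with middles \<open>w, x\<close> are the same four-cycle as a cherry from \<open>w\<close> to \<open>x\<close> through
  \<open>u\<close> followed in time by a cherry from \<open>x\<close> back to \<open>w\<close> through \<open>v\<close>. With \<open>k(u, v)\<close> the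
  number of cherries, double counting turns this into
  \<open>\<Sum> (k(u, v) - k(v, u))\<^sup>2 + 2 \<Sum> o(u, v) = 2 \<Sum> k(u, v)\<close>, where \<open>o(u, v)\<close> counts the pairs
  of opposite cherries whose time intervals overlap. Cut time at \<open>\<theta>\<close> and let \<open>c(u, v)\<close> count the
  cherries crossing \<open>\<theta>\<close>. Opposite crossing cherries overlap, and \<open>c(u, v) - c(v, u)\<close> is small
  on average by the identity for the graph and for its two halves, so
  \<open>\<Sum> c(u, v)\<^sup>2 = O(\<Sum> k(u, v))\<close>. By Cauchy-Schwarz, a graph whose degrees are \<open>O(d)\<close> with
  \<open>d = C \<surd>n\<close> and \<open>C\<close> large has few vertices with a positive fraction of \<open>d\<close> edges on both sides
  of \<open>\<theta>\<close>. Choosing \<open>\<theta>\<close> as a median splits the graph into two almost independent graphs on about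
  \<open>n / 2\<close> vertices, and \<open>2 (1 / 2)\<^sup>3\<^sup>/\<^sup>2 < 1\<close> allows an induction.

  Lower bound. The point-line incidence graph over a field with \<open>2\<^sup>k\<close> elements has no four-cycle.
  Powers of two are dense enough to serve all \<open>n\<close>, so no fact about primes is needed.
\<close>

section \<open>Cherries in graphs with edge times\<close>

text \<open>The edge order is stored as an injective time, so it restricts to subgraphs directly and
  can be cut at a number. Distinctness of the four vertices is implicit in \<open>avoids\<close>:
  edges have two ends, and the strict inequalities exclude \<open>a = c\<close> and
  \<open>b = d\<close>.\<close>

locale timed_graph =
  fixes V :: "'a set" and E :: "'a set set" and \<tau> :: "'a set \<Rightarrow> nat"
  assumes finite_V: "finite V"
    and edge_subset: "e \<in> E \<Longrightarrow> e \<subseteq> V"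
    and card_edge: "e \<in> E \<Longrightarrow> card e = 2"
    and inj_time: "inj_on \<tau> E"
    and avoids: "\<lbrakk>{a, b} \<in> E; {b, c} \<in> E; {a, d} \<in> E; {c, d} \<in> E;
      \<tau> {a, b} < \<tau> {b, c}; \<tau> {b, c} < \<tau> {a, d}; \<tau> {a, d} < \<tau> {c, d}\<rbrakk> \<Longrightarrow> False"
begin

lemma finite_E: "finite E"
  using finite_V edge_subset by (meson Pow_iff finite_Pow_iff finite_subset subsetI)

lemma no_loop: "{a, a} \<notin> E"
  using card_edge[of "{a, a}"] by auto

lemma edge_in_V: "{a, b} \<in> E \<Longrightarrow> a \<in> V \<and> b \<in> V"
  using edge_subset[of "{a, b}"] by auto

lemma time_eq_iff: "\<lbrakk>e \<in> E; f \<in> E\<rbrakk> \<Longrightarrow> \<tau> e = \<tau> f \<longleftrightarrow> e = f"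
  using inj_time by (simp add: inj_on_eq_iff)

lemma subgraph: "F \<subseteq> E \<Longrightarrow> timed_graph V F \<tau>"
proof
  assume F: "F \<subseteq> E"
  show "inj_on \<tau> F"
    by (rule inj_on_subset[OF inj_time F])
  show False if "{a, b} \<in> F" "{b, c} \<in> F" "{a, d} \<in> F" "{c, d} \<in> F"
    "\<tau> {a, b} < \<tau> {b, c}" "\<tau> {b, c} < \<tau> {a, d}" "\<tau> {a, d} < \<tau> {c, d}" for a b c d
    using avoids[of a b c d] that F by auto
qed (use finite_V edge_subset card_edge in auto)

lemma induced: "U \<subseteq> V \<Longrightarrow> timed_graph U {e \<in> E. e \<subseteq> U} \<tau>"
proof
  assume "U \<subseteq> V"
  then show "finite U"
    using finite_V finite_subset by blast
  show "inj_on \<tau> {e \<in> E. e \<subseteq> U}"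
    by (rule inj_on_subset[OF inj_time]) auto
  show False if "{a, b} \<in> {e \<in> E. e \<subseteq> U}" "{b, c} \<in> {e \<in> E. e \<subseteq> U}"
    "{a, d} \<in> {e \<in> E. e \<subseteq> U}" "{c, d} \<in> {e \<in> E. e \<subseteq> U}"
    "\<tau> {a, b} < \<tau> {b, c}" "\<tau> {b, c} < \<tau> {a, d}" "\<tau> {a, d} < \<tau> {c, d}" for a b c d
    using avoids[of a b c d] that by auto
qed (use card_edge in auto)

section \<open>Nested pairs of cherries and pairs of opposite cherries\<close>

definition mid :: "'a \<Rightarrow> 'a \<Rightarrow> 'a set" where
  "mid u v = {w. {u, w} \<in> E \<and> {w, v} \<in> E \<and> \<tau> {u, w} < \<tau> {w, v}}"

definition mids :: "'a \<Rightarrow> 'a \<Rightarrow> real" where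
  "mids u v = real (card (mid u v))"

definition cherries :: real where
  "cherries = (\<Sum>(u, v)\<in>V \<times> V. mids u v)"

lemma mid_subset: "mid u v \<subseteq> V"
  using edge_in_V by (auto simp: mid_def)

lemma finite_mid [simp]: "finite (mid u v)"
  using mid_subset finite_V finite_subset by blast

lemma sum_swap: "(\<Sum>(u, v)\<in>V \<times> V. f v u) = (\<Sum>(u, v)\<in>V \<times> V. (f u v :: real))"
  unfolding sum.cartesian_product[symmetric] by (rule sum.swap)

text \<open>If the end times came in the same order as the start times, the two intervals would be
  disjoint or would partly overlap. Disjoint intervals give the forbidden cycle read as
  \<open>u, w, v, x\<close>, overlapping ones the same cycle read as
  \<open>w, u, x, v\<close>.\<close>

lemma mid_reversed:
  assumes w: "w \<in> mid u v" and x: "x \<in> mid u v" and less: "\<tau> {u, w} < \<tau> {u, x}"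
  shows "\<tau> {x, v} < \<tau> {w, v}"
proof (rule ccontr)
  assume "\<not> \<tau> {x, v} < \<tau> {w, v}"
  have E: "{u, w} \<in> E" "{w, v} \<in> E" "{u, x} \<in> E" "{x, v} \<in> E"
    and t: "\<tau> {u, w} < \<tau> {w, v}" "\<tau> {u, x} < \<tau> {x, v}"
    using w x by (auto simp: mid_def)
  have ne: "w \<noteq> x" "u \<noteq> v" "u \<noteq> w" "u \<noteq> x" "w \<noteq> v" "x \<noteq> v"
    using less t E no_loop by (auto simp: insert_commute)
  have "{x, v} \<noteq> {w, v}" "{w, v} \<noteq> {u, x}"
    using ne by (auto simp: doubleton_eq_iff)
  then have t': "\<tau> {w, v} < \<tau> {x, v}" "\<tau> {w, v} \<noteq> \<tau> {u, x}"
    using \<open>\<not> \<tau> {x, v} < \<tau> {w, v}\<close> time_eq_iff[OF E(2,4)] time_eq_iff[OF E(2,3)] by auto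
  show False
  proof (cases "\<tau> {w, v} < \<tau> {u, x}")
    case True
    then show False
      using avoids[of u w v x] E t less t' by (simp add: insert_commute)
  next
    case False
    then show False
      using avoids[of w u x v] E t less t' by (simp add: insert_commute)
  qed
qed

text \<open>Comparing start times is enough, because \<open>mid_reversed\<close> reverses the end
  times.\<close>

definition nested :: "'a \<Rightarrow> 'a \<Rightarrow> ('a \<times> 'a) set" where
  "nested u v = {(w, x). w \<in> mid u v \<and> x \<in> mid u v \<and> \<tau> {u, w} < \<tau> {u, x}}"

definition consec :: "'a \<Rightarrow> 'a \<Rightarrow> ('a \<times> 'a) set" where
  "consec u v = {(w, x). w \<in> mid u v \<and> x \<in> mid v u \<and> \<tau> {w, v} < \<tau> {v, x}}"

text \<open>Both sides describe the four-cycle with \<open>uw < ux < xv < wv\<close>, read once from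
  \<open>u\<close> and \<open>v\<close> and once from \<open>w\<close> and \<open>x\<close>. From
  left to right the last comparison is \<open>mid_reversed\<close>; this is where avoidance enters
  the counting.\<close>

lemma nested_iff_consec: "(w, x) \<in> nested u v \<longleftrightarrow> (u, v) \<in> consec w x"
proof
  assume "(w, x) \<in> nested u v"
  then show "(u, v) \<in> consec w x"
    using mid_reversed[of w u v x] by (auto simp: nested_def consec_def mid_def insert_commute)
next
  assume "(u, v) \<in> consec w x"
  then show "(w, x) \<in> nested u v"
    by (auto simp: nested_def consec_def mid_def insert_commute)
qed

lemma nested_subset: "nested u v \<subseteq> V \<times> V" and consec_subset: "consec u v \<subseteq> V \<times> V"
  using mid_subset by (auto simp: nested_def consec_def)

lemma sum_nested:
  "(\<Sum>(u, v)\<in>V \<times> V. real (card (nested u v))) = (\<Sum>(u, v)\<in>V \<times> V. real (card (consec u v)))"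
proof -
  have "card (SIGMA p:V \<times> V. nested (fst p) (snd p)) = card (SIGMA p:V \<times> V. consec (fst p) (snd p))"
  proof (rule bij_betw_same_card[of prod.swap])
    show "bij_betw prod.swap (SIGMA p:V \<times> V. nested (fst p) (snd p)) (SIGMA p:V \<times> V. consec (fst p) (snd p))"
    proof (rule bij_betw_byWitness[of _ prod.swap])
      show "prod.swap ` (SIGMA p:V \<times> V. nested (fst p) (snd p)) \<subseteq> (SIGMA p:V \<times> V. consec (fst p) (snd p))"
        using nested_subset nested_iff_consec by (clarsimp simp: image_subset_iff) blast
      show "prod.swap ` (SIGMA p:V \<times> V. consec (fst p) (snd p)) \<subseteq> (SIGMA p:V \<times> V. nested (fst p) (snd p))"
        using consec_subset nested_iff_consec by (clarsimp simp: image_subset_iff) blast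
    qed auto
  qed
  moreover have "finite (nested u v)" "finite (consec u v)" for u v
    using nested_subset consec_subset finite_V by (meson finite_SigmaI finite_subset)+
  ultimately have "(\<Sum>p\<in>V \<times> V. card (nested (fst p) (snd p))) = (\<Sum>p\<in>V \<times> V. card (consec (fst p) (snd p)))"
    using finite_V by (simp add: card_SigmaI)
  then show ?thesis
    by (simp add: case_prod_beta flip: of_nat_sum)
qed

text \<open>Distinct middles have distinct start times, so an ordered pair of middles is nested,
  nested in reverse, or diagonal.\<close>

lemma card_nested: "2 * real (card (nested u v)) = mids u v ^ 2 - mids u v"
proof -
  let ?M = "mid u v"
  have part: "?M \<times> ?M = nested u v \<union> prod.swap ` nested u v \<union> (\<lambda>w. (w, w)) ` ?M"
    (is "_ = ?A \<union> ?B \<union> ?C")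
  proof -
    have "w = x \<or> \<tau> {u, w} < \<tau> {u, x} \<or> \<tau> {u, x} < \<tau> {u, w}" if "w \<in> ?M" "x \<in> ?M" for w x
    proof -
      have "{u, w} \<in> E" "{u, x} \<in> E" using that by (auto simp: mid_def)
      then show ?thesis
        using time_eq_iff[of "{u, w}" "{u, x}"] by (auto simp: doubleton_eq_iff)
    qed
    then show ?thesis
      by (fastforce simp: nested_def image_iff)
  qed
  have fin: "finite ?A"
    by (rule finite_subset[of _ "?M \<times> ?M"]) (auto simp: nested_def)
  have "card (?M \<times> ?M) = card (?A \<union> ?B) + card ?C"
    unfolding part using fin by (intro card_Un_disjoint) (auto simp: nested_def)
  also have "card (?A \<union> ?B) = card ?A + card ?B"
    using fin by (intro card_Un_disjoint) (auto simp: nested_def)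
  also have "card ?B = card ?A"
    by (simp add: card_image)
  also have "card ?C = card ?M"
    by (simp add: card_image inj_on_def)
  finally have "card ?M * card ?M = 2 * card ?A + card ?M"
    by (simp add: card_cartesian_product)
  then have "real (card ?M) * real (card ?M) = 2 * real (card ?A) + real (card ?M)"
    by (metis of_nat_add of_nat_mult of_nat_numeral)
  then show ?thesis
    by (simp add: mids_def power2_eq_square)
qed

text \<open>The swap is there because \<open>consec v u\<close> lists the cherry from
  \<open>v\<close> to \<open>u\<close> first. What remains are the opposite cherries of which
  neither is over before the other begins.\<close>

definition overlap :: "'a \<Rightarrow> 'a \<Rightarrow> ('a \<times> 'a) set" where
  "overlap u v = mid u v \<times> mid v u - consec u v - prod.swap ` consec v u"

lemma card_consec:
  "real (card (consec u v)) + real (card (consec v u)) + real (card (overlap u v)) = mids u v * mids v u"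
proof -
  let ?A = "consec u v" and ?B = "prod.swap ` consec v u" and ?P = "mid u v \<times> mid v u"
  have sub: "?A \<subseteq> ?P" "?B \<subseteq> ?P" by (auto simp: consec_def)
  have fin: "finite ?P" "finite ?A" "finite ?B" using sub finite_subset[of _ ?P] by simp_all
  have "(w, x) \<notin> ?B" if "(w, x) \<in> ?A" for w x
    using that by (auto simp: consec_def mid_def insert_commute)
  then have disj: "?A \<inter> ?B = {}" by auto
  have "card (overlap u v) = card ?P - card (?A \<union> ?B)"
  proof -
    have "overlap u v = ?P - (?A \<union> ?B)"
      by (auto simp: overlap_def)
    then show ?thesis
      using sub fin by (simp add: card_Diff_subset)
  qed
  moreover have "card (?A \<union> ?B) \<le> card ?P"
    using sub fin by (intro card_mono) auto
  moreover have "card (?A \<union> ?B) = card (consec u v) + card (consec v u)"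
    using fin disj by (simp add: card_Un_disjoint card_image)
  ultimately have "card (consec u v) + card (consec v u) + card (overlap u v) = card (mid u v) * card (mid v u)"
    by (simp add: card_cartesian_product)
  then show ?thesis
    unfolding mids_def by (metis of_nat_add of_nat_mult)
qed

text \<open>Expand the square: \<open>card_nested\<close> evaluates the squares,
  \<open>card_consec\<close> the mixed products, and by \<open>sum_nested\<close> the nested and the
  consecutive pairs cancel.\<close>

lemma balance:
  "(\<Sum>(u, v)\<in>V \<times> V. (mids u v - mids v u)\<^sup>2) + 2 * (\<Sum>(u, v)\<in>V \<times> V. real (card (overlap u v)))
     = 2 * cherries"
proof -
  let ?S = "\<lambda>f :: 'a \<Rightarrow> 'a \<Rightarrow> real. \<Sum>(u, v)\<in>V \<times> V. f u v"
  have lin: "?S (\<lambda>u v. f u v + g u v) = ?S f + ?S g" "?S (\<lambda>u v. f u v - g u v) = ?S f - ?S g"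
    "?S (\<lambda>u v. c * f u v) = c * ?S f" for f g :: "'a \<Rightarrow> 'a \<Rightarrow> real" and c
    by (simp_all add: case_prod_beta sum.distrib sum_subtractf sum_distrib_left)
  have "2 * ?S (\<lambda>u v. real (card (nested u v))) = ?S (\<lambda>u v. mids u v ^ 2) - cherries"
    unfolding lin(3)[symmetric] card_nested lin cherries_def ..
  moreover have "?S (\<lambda>u v. mids u v * mids v u) = 2 * ?S (\<lambda>u v. real (card (consec u v))) + ?S (\<lambda>u v. real (card (overlap u v)))"
    unfolding card_consec[symmetric] lin
    using sum_swap[of "\<lambda>u v. real (card (consec u v))"] by simp
  moreover have "?S (\<lambda>u v. (mids u v - mids v u)\<^sup>2) = ?S (\<lambda>u v. mids u v ^ 2) + ?S (\<lambda>u v. mids v u ^ 2) - 2 * ?S (\<lambda>u v. mids u v * mids v u)"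
    unfolding lin(3)[symmetric] lin(1)[symmetric] lin(2)[symmetric]
    by (simp add: power2_diff algebra_simps)
  moreover have "?S (\<lambda>u v. mids v u ^ 2) = ?S (\<lambda>u v. mids u v ^ 2)"
    by (rule sum_swap)
  ultimately show ?thesis
    using sum_nested by simp
qed

section \<open>Degrees, and cherries crossing a threshold\<close>

definition deg :: "'a \<Rightarrow> nat" where
  "deg w = card {e \<in> E. w \<in> e}"

definition deg_lo :: "nat \<Rightarrow> 'a \<Rightarrow> nat" where
  "deg_lo \<theta> w = card {e \<in> E. w \<in> e \<and> \<tau> e < \<theta>}"

definition deg_hi :: "nat \<Rightarrow> 'a \<Rightarrow> nat" where
  "deg_hi \<theta> w = card {e \<in> E. w \<in> e \<and> \<theta> \<le> \<tau> e}"

definition cross :: "nat \<Rightarrow> 'a \<Rightarrow> 'a \<Rightarrow> 'a set" where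
  "cross \<theta> u v = {w. {u, w} \<in> E \<and> {w, v} \<in> E \<and> \<tau> {u, w} < \<theta> \<and> \<theta> \<le> \<tau> {w, v}}"

lemma card_neighbours:
  assumes "F \<subseteq> E"
  shows "card {u. {u, w} \<in> F} = card {e \<in> F. w \<in> e}"
proof (rule bij_betw_same_card[of "\<lambda>u. {u, w}"])
  have "\<exists>u. e = {u, w}" if "e \<in> F" "w \<in> e" for e
  proof -
    have "card e = 2" using that assms card_edge by auto
    then obtain x y where "e = {x, y}" by (auto simp: card_2_iff)
    then show ?thesis using that by (cases "w = x") auto
  qed
  then show "bij_betw (\<lambda>u. {u, w}) {u. {u, w} \<in> F} {e \<in> F. w \<in> e}"
    by (auto simp: bij_betw_def inj_on_def doubleton_eq_iff image_iff)
qed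

lemma sum_edges: "(\<Sum>w\<in>V. deg w) = 2 * card E"
proof -
  have "(\<Sum>w\<in>V. deg w) = (\<Sum>w\<in>V. \<Sum>e\<in>E. if w \<in> e then 1 else 0)"
    unfolding deg_def using finite_E by (simp add: sum.If_cases Int_def)
  also have "\<dots> = (\<Sum>e\<in>E. \<Sum>w\<in>V. if w \<in> e then 1 else 0)"
    by (rule sum.swap)
  also have "\<dots> = (\<Sum>e\<in>E. card e)"
    using finite_V edge_subset by (intro sum.cong) (auto simp: sum.If_cases Int_absorb1)
  finally show ?thesis
    by (simp add: card_edge)
qed

lemma card_E_le: "card E \<le> card V * card V"
proof -
  have "E \<subseteq> (\<lambda>(u, v). {u, v}) ` (V \<times> V)"
    using card_edge edge_subset by (force simp: card_2_iff)
  then have "card E \<le> card (V \<times> V)"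
    using finite_V surj_card_le[of "V \<times> V" E] by blast
  then show ?thesis by (simp add: card_cartesian_product)
qed

text \<open>Paths with two edges are counted by their ends and by their middle vertex. The sets of
  allowed ends are left general to serve both \<open>sum_cross\<close> and
  \<open>cherries_le\<close>.\<close>

lemma sum_paths:
  assumes M: "\<And>u v w. w \<in> M u v \<longleftrightarrow> u \<in> A w \<and> v \<in> B w"
    and sub: "\<And>w. A w \<subseteq> V" "\<And>w. B w \<subseteq> V" "\<And>u v. M u v \<subseteq> V"
  shows "(\<Sum>(u, v)\<in>V \<times> V. real (card (M u v))) = (\<Sum>w\<in>V. real (card (A w)) * real (card (B w)))"
proof -
  have "card (M u v) = (\<Sum>w\<in>V. if w \<in> M u v then 1 else 0)" for u v
    using finite_V sub(3)[of u v] by (simp add: sum.If_cases Int_absorb1)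
  then have "(\<Sum>(u, v)\<in>V \<times> V. card (M u v)) = (\<Sum>p\<in>V \<times> V. \<Sum>w\<in>V. if w \<in> M (fst p) (snd p) then 1 else 0)"
    by (simp add: case_prod_beta)
  also have "\<dots> = (\<Sum>w\<in>V. \<Sum>p\<in>V \<times> V. if w \<in> M (fst p) (snd p) then 1 else 0)"
    by (rule sum.swap)
  also have "\<dots> = (\<Sum>w\<in>V. card (A w \<times> B w))"
  proof (rule sum.cong[OF refl])
    fix w
    have "V \<times> V \<inter> {p. w \<in> M (fst p) (snd p)} = A w \<times> B w"
      using M sub by fastforce
    then show "(\<Sum>p\<in>V \<times> V. if w \<in> M (fst p) (snd p) then 1 else 0) = card (A w \<times> B w)"
      using finite_V by (simp add: sum.If_cases)
  qed
  finally have "real (\<Sum>(u, v)\<in>V \<times> V. card (M u v)) = real (\<Sum>w\<in>V. card (A w \<times> B w))"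
    by simp
  then show ?thesis
    by (simp add: card_cartesian_product case_prod_beta)
qed

lemma sum_cross:
  "(\<Sum>(u, v)\<in>V \<times> V. real (card (cross \<theta> u v))) = (\<Sum>w\<in>V. real (deg_lo \<theta> w) * real (deg_hi \<theta> w))"
proof -
  have "deg_lo \<theta> w = card {u. {u, w} \<in> {e \<in> E. \<tau> e < \<theta>}}" for w
    unfolding deg_lo_def by (subst card_neighbours) (auto intro: arg_cong[of _ _ card])
  moreover have "deg_hi \<theta> w = card {u. {u, w} \<in> {e \<in> E. \<theta> \<le> \<tau> e}}" for w
    unfolding deg_hi_def by (subst card_neighbours) (auto intro: arg_cong[of _ _ card])
  ultimately show ?thesis
    by (simp only:, intro sum_paths) (use edge_in_V in \<open>auto simp: cross_def insert_commute\<close>)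
qed

lemma cherries_le: "cherries \<le> (\<Sum>w\<in>V. real (deg w) ^ 2)"
proof -
  let ?N = "\<lambda>w. {u. {u, w} \<in> E}"
  let ?M = "\<lambda>u v. {w. {u, w} \<in> E \<and> {w, v} \<in> E}"
  have "finite (?M u v)" for u v
    by (rule finite_subset[OF _ finite_V]) (use edge_in_V in auto)
  then have "cherries \<le> (\<Sum>(u, v)\<in>V \<times> V. real (card (?M u v)))"
    unfolding cherries_def mids_def
    by (intro sum_mono) (auto simp: mid_def intro!: card_mono)
  also have "\<dots> = (\<Sum>w\<in>V. real (card (?N w)) * real (card (?N w)))"
    by (rule sum_paths) (use edge_in_V in \<open>auto simp: insert_commute\<close>)
  finally show ?thesis
    unfolding deg_def by (simp add: card_neighbours power2_eq_square)
qed

text \<open>A cherry lies before the cut, after it, or across it, so \<open>c u v - c v u\<close> is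
  the imbalance of the graph minus those of its two halves. With \<open>K\<close> cherries and
  \<open>O\<close> overlapping pairs, \<open>balance\<close> bounds the sum of its squares by
  \<open>3 * (2 K - 2 O + 2 K)\<close>. Half of this plus the mixed products, which are at most
  \<open>O\<close>, is at most \<open>6 K\<close>.\<close>

lemma sum_cross_squares: "(\<Sum>(u, v)\<in>V \<times> V. real (card (cross \<theta> u v)) ^ 2) \<le> 6 * cherries"
proof -
  define E1 where "E1 = {e \<in> E. \<tau> e < \<theta>}"
  define E2 where "E2 = {e \<in> E. \<theta> \<le> \<tau> e}"
  interpret G1: timed_graph V E1 \<tau>
    by (rule subgraph) (auto simp: E1_def)
  interpret G2: timed_graph V E2 \<tau>
    by (rule subgraph) (auto simp: E2_def)
  let ?S = "\<lambda>f :: 'a \<Rightarrow> 'a \<Rightarrow> real. \<Sum>p\<in>V \<times> V. f (fst p) (snd p)"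
  define c where "c u v = real (card (cross \<theta> u v))" for u v
  have finc: "finite (cross \<theta> u v)" for u v
    by (rule finite_subset[OF _ finite_mid[of u v]]) (auto simp: cross_def mid_def)
  have decomp: "mids u v = G1.mids u v + G2.mids u v + c u v" for u v
  proof -
    have "mid u v = G1.mid u v \<union> G2.mid u v \<union> cross \<theta> u v"
      unfolding mid_def G1.mid_def G2.mid_def cross_def by (auto simp: E1_def E2_def)
    moreover have "card (G1.mid u v \<union> G2.mid u v \<union> cross \<theta> u v)
        = card (G1.mid u v \<union> G2.mid u v) + card (cross \<theta> u v)"
      using finc by (intro card_Un_disjoint finite_UnI G1.finite_mid G2.finite_mid)
        (auto simp: G1.mid_def G2.mid_def cross_def, auto simp: E1_def E2_def)
    moreover have "card (G1.mid u v \<union> G2.mid u v) = card (G1.mid u v) + card (G2.mid u v)"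
      by (intro card_Un_disjoint G1.finite_mid G2.finite_mid)
        (auto simp: G1.mid_def G2.mid_def, auto simp: E1_def E2_def)
    ultimately show ?thesis
      by (simp add: mids_def G1.mids_def G2.mids_def c_def)
  qed
  \<comment> \<open>The time intervals of two crossing cherries both straddle \<theta>, so neither
    ends before the other begins.\<close>
  have ov: "c u v * c v u \<le> real (card (overlap u v))" for u v
  proof -
    have "cross \<theta> u v \<times> cross \<theta> v u \<subseteq> overlap u v"
      by (auto simp: cross_def overlap_def mid_def consec_def insert_commute)
    moreover have "finite (overlap u v)"
      by (auto simp: overlap_def)
    ultimately have "card (cross \<theta> u v \<times> cross \<theta> v u) \<le> card (overlap u v)"
      by (rule card_mono[rotated])
    then show ?thesis
      by (simp add: c_def card_cartesian_product flip: of_nat_mult)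
  qed
  have c0: "c u v \<ge> 0" for u v by (simp add: c_def)
  have bal: "?S (\<lambda>u v. (mids u v - mids v u)\<^sup>2) + 2 * ?S (\<lambda>u v. real (card (overlap u v))) = 2 * cherries"
    "?S (\<lambda>u v. (G1.mids u v - G1.mids v u)\<^sup>2) + 2 * ?S (\<lambda>u v. real (card (G1.overlap u v))) = 2 * G1.cherries"
    "?S (\<lambda>u v. (G2.mids u v - G2.mids v u)\<^sup>2) + 2 * ?S (\<lambda>u v. real (card (G2.overlap u v))) = 2 * G2.cherries"
    using balance G1.balance G2.balance by (simp_all add: case_prod_beta)
  have "0 \<le> ?S (\<lambda>u v. real (card (overlap u v)))" "0 \<le> ?S (\<lambda>u v. real (card (G1.overlap u v)))"
    "0 \<le> ?S (\<lambda>u v. real (card (G2.overlap u v)))"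
    by (auto intro: sum_nonneg)
  moreover have "G1.cherries + G2.cherries \<le> cherries"
    unfolding cherries_def G1.cherries_def G2.cherries_def sum.distrib[symmetric]
    using c0 by (intro sum_mono) (auto simp: decomp)
  moreover have "?S (\<lambda>u v. c u v * c v u) \<le> ?S (\<lambda>u v. real (card (overlap u v)))"
    using ov by (intro sum_mono) auto
  moreover have "?S (\<lambda>u v. (c u v - c v u)\<^sup>2) \<le> ?S (\<lambda>u v. 3 * (mids u v - mids v u)\<^sup>2
      + 3 * (G1.mids u v - G1.mids v u)\<^sup>2 + 3 * (G2.mids u v - G2.mids v u)\<^sup>2)"
  proof (intro sum_mono)
    fix p :: "'a \<times> 'a"
    let ?u = "fst p" and ?v = "snd p"
    have *: "(x - y - z)\<^sup>2 \<le> 3 * x\<^sup>2 + 3 * y\<^sup>2 + 3 * z\<^sup>2" for x y z :: real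
      using zero_le_power2[of "x + y"] zero_le_power2[of "x + z"] zero_le_power2[of "y - z"]
      by (simp add: power2_eq_square algebra_simps)
    show "(c ?u ?v - c ?v ?u)\<^sup>2 \<le> 3 * (mids ?u ?v - mids ?v ?u)\<^sup>2
      + 3 * (G1.mids ?u ?v - G1.mids ?v ?u)\<^sup>2 + 3 * (G2.mids ?u ?v - G2.mids ?v ?u)\<^sup>2"
      using *[of "mids ?u ?v - mids ?v ?u" "G1.mids ?u ?v - G1.mids ?v ?u" "G2.mids ?u ?v - G2.mids ?v ?u"]
      by (simp add: decomp algebra_simps)
  qed
  moreover have "?S (\<lambda>u v. 3 * (mids u v - mids v u)\<^sup>2
      + 3 * (G1.mids u v - G1.mids v u)\<^sup>2 + 3 * (G2.mids u v - G2.mids v u)\<^sup>2)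
     = 3 * ?S (\<lambda>u v. (mids u v - mids v u)\<^sup>2)
      + 3 * ?S (\<lambda>u v. (G1.mids u v - G1.mids v u)\<^sup>2) + 3 * ?S (\<lambda>u v. (G2.mids u v - G2.mids v u)\<^sup>2)"
    by (simp only: sum.distrib sum_distrib_left)
  moreover have "?S (\<lambda>u v. (c u v - c v u)\<^sup>2)
      = ?S (\<lambda>u v. (c u v)\<^sup>2) + ?S (\<lambda>u v. (c v u)\<^sup>2) - 2 * ?S (\<lambda>u v. c u v * c v u)"
    by (simp add: power2_diff sum.distrib sum_subtractf sum_distrib_left mult.assoc)
  moreover have "?S (\<lambda>u v. (c v u)\<^sup>2) = ?S (\<lambda>u v. (c u v)\<^sup>2)"
    using sum_swap[of "\<lambda>u v. (c u v)\<^sup>2"] by (simp add: case_prod_beta)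
  ultimately have "?S (\<lambda>u v. (c u v)\<^sup>2) \<le> 6 * cherries"
    using bal by linarith
  then show ?thesis
    by (simp add: c_def case_prod_beta)
qed

text \<open>Cauchy-Schwarz over all pairs of vertices passes from the squares in
  \<open>sum_cross_squares\<close> to the number of crossing cherries.\<close>

lemma sum_deg_lo_hi:
  "(\<Sum>w\<in>V. real (deg_lo \<theta> w) * real (deg_hi \<theta> w))\<^sup>2 \<le> 6 * real (card V) ^ 2 * (\<Sum>w\<in>V. real (deg w) ^ 2)"
proof -
  let ?c = "\<lambda>p. real (card (cross \<theta> (fst p) (snd p)))"
  have "(\<Sum>p\<in>V \<times> V. ?c p)\<^sup>2 \<le> (\<Sum>p\<in>V \<times> V. (?c p)\<^sup>2) * real (card (V \<times> V))"
    using sum_squared_le_sum_of_squares[of ?c "V \<times> V"] finite_V by (simp add: mult.commute)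
  also have "\<dots> \<le> 6 * (\<Sum>w\<in>V. real (deg w) ^ 2) * real (card (V \<times> V))"
    using sum_cross_squares[of \<theta>] cherries_le by (intro mult_right_mono) (auto simp: case_prod_beta)
  finally show ?thesis
    using sum_cross[of \<theta>] by (simp add: case_prod_beta card_cartesian_product power2_eq_square algebra_simps)
qed

section \<open>The upper bound\<close>

text \<open>In the main case the vertices with more than \<open>s\<close> edges on both sides of
  \<theta> are put into both parts. A lost edge then joins an early vertex, with at most
  \<open>s\<close> edges from \<theta> on, to one with at most \<open>s\<close> edges before
  \<theta>. Its time decides to which end it is charged, so every vertex is charged at most
  \<open>s\<close>.\<close>

lemma bisection:
  fixes s :: real
  assumes s: "0 \<le> s"
  obtains U1 U2 \<theta> where "U1 \<subseteq> V" "U2 \<subseteq> V"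
    "real (card E) \<le> card {e \<in> E. e \<subseteq> U1} + card {e \<in> E. e \<subseteq> U2} + s * card V"
    "real (card U1) \<le> card V / 2 + 2 + card {w \<in> V. s < deg_lo \<theta> w \<and> s < deg_hi \<theta> w}"
    "real (card U2) \<le> card V / 2"
proof -
  define early where "early \<theta> = {w \<in> V. real (deg_hi \<theta> w) \<le> s}" for \<theta>
  have sub: "early \<theta> \<subseteq> V" for \<theta> by (auto simp: early_def)
  have fin: "finite (early \<theta>)" for \<theta> by (rule finite_subset[OF sub finite_V])
  define P where "P \<theta> \<longleftrightarrow> card V \<le> 2 * card (early \<theta>)" for \<theta>
  have "finite (\<tau> ` E)" using finite_E by simp
  then obtain t where "\<forall>x\<in>\<tau> ` E. x < t"
    using finite_nat_set_iff_bounded by auto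
  then have "{e \<in> E. w \<in> e \<and> t \<le> \<tau> e} = {}" for w
    by (auto simp: not_le)
  then have "deg_hi t w = 0" for w
    unfolding deg_hi_def by (simp only: card.empty)
  then have "early t = V"
    using s by (simp add: early_def)
  then have "P t" by (simp add: P_def)
  \<comment> \<open>By minimality the early vertices are about half of all: only the two ends of one edge
    can become early when the threshold grows by 1.\<close>
  define \<theta> where "\<theta> = (LEAST \<theta>. P \<theta>)"
  have "P \<theta>" unfolding \<theta>_def using \<open>P t\<close> by (rule LeastI)
  define U2 where "U2 = V - early \<theta>"
  have cU2: "card U2 = card V - card (early \<theta>)"
    unfolding U2_def using fin sub by (simp add: card_Diff_subset)
  have U2: "real (card U2) \<le> card V / 2"
    using \<open>P \<theta>\<close> cU2 unfolding P_def by linarith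
  define M where "M = {w \<in> V. s < deg_lo \<theta> w \<and> s < deg_hi \<theta> w}"
  define late where "late = U2 - M"
  have late: "real (deg_lo \<theta> w) \<le> s" if "w \<in> late" for w
    using that by (auto simp: late_def U2_def M_def early_def)
  define H where "H = (\<Union>x\<in>early \<theta>. {e \<in> E. x \<in> e \<and> \<theta> \<le> \<tau> e})"
  define L where "L = (\<Union>y\<in>late. {e \<in> E. y \<in> e \<and> \<tau> e < \<theta>})"
  have "finite late" using finite_V by (simp add: late_def U2_def)
  have HL: "finite H" "finite L"
    using finite_E by (auto simp: H_def L_def intro: finite_subset[of _ E])
  have "real (card H) \<le> (\<Sum>x\<in>early \<theta>. real (deg_hi \<theta> x))"
    unfolding H_def deg_hi_def of_nat_sum[symmetric] by (intro of_nat_mono card_UN_le fin)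
  also have "\<dots> \<le> card (early \<theta>) * s"
    by (intro sum_bounded_above) (auto simp: early_def)
  finally have cH: "real (card H) \<le> card (early \<theta>) * s" .
  have "real (card L) \<le> (\<Sum>y\<in>late. real (deg_lo \<theta> y))"
    unfolding L_def deg_lo_def of_nat_sum[symmetric] by (intro of_nat_mono card_UN_le \<open>finite late\<close>)
  also have "\<dots> \<le> card late * s"
    using late by (intro sum_bounded_above) auto
  also have "\<dots> \<le> card U2 * s"
    using s finite_V by (intro mult_right_mono of_nat_mono card_mono) (auto simp: late_def U2_def)
  finally have cL: "real (card L) \<le> card U2 * s" .
  have "card (early \<theta>) * s + card U2 * s = s * card V"
    using cU2 card_mono[OF finite_V sub[of \<theta>]] by (simp add: of_nat_diff algebra_simps)
  then have cHL: "real (card H) + real (card L) \<le> s * card V"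
    using cH cL by linarith
  show thesis
  proof (cases \<theta>)
    \<comment> \<open>There is no preceding threshold to compare with. As no edge has time below 0,
      every edge meeting an early vertex lies in \<open>H\<close>, so the first part can be
      empty.\<close>
    case 0
    have "E \<subseteq> {e \<in> E. e \<subseteq> U2} \<union> H"
      using edge_subset 0 by (fastforce simp: U2_def H_def)
    then have "card E \<le> card ({e \<in> E. e \<subseteq> U2} \<union> H)"
      using finite_E HL by (intro card_mono) auto
    also have "\<dots> \<le> card {e \<in> E. e \<subseteq> U2} + card H"
      by (rule card_Un_le)
    finally have "real (card E) \<le> card {e \<in> E. e \<subseteq> {}} + card {e \<in> E. e \<subseteq> U2} + s * card V"
      using cHL by linarith
    with U2 show thesis
      by (intro that[of "{}" U2 \<theta>]) (auto simp: U2_def)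
  next
    case (Suc t)
    have "\<not> P t"
      using not_less_Least[of t P] Suc by (simp add: \<theta>_def)
    let ?T = "{e \<in> E. \<tau> e = t}"
    have "early \<theta> \<subseteq> early t \<union> \<Union>?T"
    proof
      fix w assume w: "w \<in> early \<theta>"
      show "w \<in> early t \<union> \<Union>?T"
      proof (cases "w \<in> \<Union>?T")
        case False
        then have "{e \<in> E. w \<in> e \<and> t \<le> \<tau> e} = {e \<in> E. w \<in> e \<and> \<theta> \<le> \<tau> e}"
          using Suc by (auto simp: Suc_le_eq nat_less_le)
        then show ?thesis
          using w by (simp add: early_def deg_hi_def)
      qed simp
    qed
    moreover have "finite (\<Union>?T) \<and> card (\<Union>?T) \<le> 2"
    proof (cases "?T = {}")
      case False
      then obtain e where "e \<in> E" "\<tau> e = t" by auto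
      then have "?T = {e}" using time_eq_iff by auto
      then show ?thesis using card_edge[OF \<open>e \<in> E\<close>] by (auto intro: card_ge_0_finite)
    qed (simp only: Union_empty, simp)
    ultimately have "card (early \<theta>) \<le> card (early t \<union> \<Union>?T)"
      using fin by (intro card_mono) auto
    also have "\<dots> \<le> card (early t) + card (\<Union>?T)"
      by (rule card_Un_le)
    finally have "real (card (early \<theta>)) \<le> card V / 2 + 2"
      using \<open>\<not> P t\<close> \<open>finite (\<Union>?T) \<and> card (\<Union>?T) \<le> 2\<close> unfolding P_def by linarith
    moreover have "card (early \<theta> \<union> M) \<le> card (early \<theta>) + card M"
      by (rule card_Un_le)
    ultimately have U1: "real (card (early \<theta> \<union> M)) \<le> card V / 2 + 2 + card M"
      by linarith
    have "E \<subseteq> {e \<in> E. e \<subseteq> early \<theta> \<union> M} \<union> {e \<in> E. e \<subseteq> U2} \<union> (H \<union> L)"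
    proof
      fix e assume e: "e \<in> E"
      have "e \<in> H \<union> L" if "\<not> e \<subseteq> early \<theta> \<union> M" "\<not> e \<subseteq> U2"
      proof -
        obtain x y where "x \<in> e" "x \<notin> U2" "y \<in> e" "y \<notin> early \<theta> \<union> M"
          using \<open>\<not> e \<subseteq> early \<theta> \<union> M\<close> \<open>\<not> e \<subseteq> U2\<close> by blast
        then have "x \<in> early \<theta>" "y \<in> late"
          using edge_subset[OF e] by (auto simp: U2_def late_def)
        then show ?thesis
          using e \<open>x \<in> e\<close> \<open>y \<in> e\<close> by (cases "\<theta> \<le> \<tau> e") (auto simp: H_def L_def)
      qed
      then show "e \<in> {e \<in> E. e \<subseteq> early \<theta> \<union> M} \<union> {e \<in> E. e \<subseteq> U2} \<union> (H \<union> L)"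
        using e by blast
    qed
    then have "card E \<le> card ({e \<in> E. e \<subseteq> early \<theta> \<union> M} \<union> {e \<in> E. e \<subseteq> U2} \<union> (H \<union> L))"
      using finite_E HL by (intro card_mono) auto
    also have "\<dots> \<le> card {e \<in> E. e \<subseteq> early \<theta> \<union> M} + card {e \<in> E. e \<subseteq> U2} + (card H + card L)"
      by (meson add_mono card_Un_le order_trans)
    finally have "real (card E) \<le> card {e \<in> E. e \<subseteq> early \<theta> \<union> M} + card {e \<in> E. e \<subseteq> U2} + s * card V"
      using cHL by linarith
    with U1 U2 sub[of \<theta>] show thesis
      by (intro that[of "early \<theta> \<union> M" U2 \<theta>]) (auto simp: U2_def M_def)
  qed
qed

end

text \<open>
  A vertex is replaced by copies, each of which inherits \<open>D\<close> consecutive edges in time. No copy of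
  \<open>C\<^sub>4\<^sup>1\<^sup>2\<^sup>4\<^sup>3\<close> arises because the projection to the original graph is injective on edges.
\<close>

lemma split_vertices:
  fixes V :: "nat set"
  assumes "timed_graph V E \<tau>" and D: "0 < D"
  obtains V' E' \<tau>' where "timed_graph (V' :: nat set) E' \<tau>'" "card E' = card E"
    "\<And>w. timed_graph.deg E' w \<le> D" "D * card V' \<le> D * card V + 2 * card E"
proof -
  interpret timed_graph V E \<tau> by fact
  define rk where "rk u e = card {f \<in> E. u \<in> f \<and> \<tau> f < \<tau> e}" for u e
  \<comment> \<open>Each end \<open>u\<close> of \<open>e\<close> becomes the copy of
    \<open>u\<close> that owns the block of \<open>D\<close> consecutive ranks containing
    \<open>rk u e\<close>.\<close>
  define g where "g e = (\<lambda>u. prod_encode (u, rk u e div D)) ` e" for e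
  define p where "p x = fst (prod_decode x)" for x
  have pg: "p ` g e = e" for e
    by (simp add: p_def g_def image_image)
  have inj_g: "inj g"
    by (rule inj_on_inverseI[of _ "(`) p"]) (simp add: pg)
  let ?V = "prod_encode ` (SIGMA u:V. {..deg u div D})" and ?E = "g ` E" and ?\<tau> = "\<lambda>e. \<tau> (p ` e)"
  have rk_le: "rk u e \<le> deg u" for u e
    unfolding rk_def deg_def using finite_E by (auto intro!: card_mono)
  have pE: "{p a, p b} \<in> E" if "{a, b} \<in> ?E" for a b
    using that pg by (metis (no_types, lifting) image_empty image_insert imageE)
  interpret G: timed_graph ?V ?E ?\<tau>
  proof
    show "finite ?V" using finite_V by simp
    show "e \<subseteq> ?V" if "e \<in> ?E" for e
      using that edge_subset rk_le by (force simp: g_def intro: div_le_mono)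
    show "card e = 2" if e: "e \<in> ?E" for e
    proof -
      obtain f where f: "e = g f" "f \<in> E" using e by blast
      then have "card e = card f" unfolding f g_def by (intro card_image) (auto simp: inj_on_def)
      then show ?thesis using card_edge f by simp
    qed
    show "inj_on ?\<tau> ?E"
      using inj_time by (auto simp: inj_on_def pg)
    show False if "{a, b} \<in> ?E" "{b, c} \<in> ?E" "{a, d} \<in> ?E" "{c, d} \<in> ?E"
      "?\<tau> {a, b} < ?\<tau> {b, c}" "?\<tau> {b, c} < ?\<tau> {a, d}" "?\<tau> {a, d} < ?\<tau> {c, d}" for a b c d
      using that avoids[of "p a" "p b" "p c" "p d"] pE by simp
  qed
  have deg_le: "G.deg w \<le> D" for w
  proof -
    obtain u i where w: "w = prod_encode (u, i)"
      by (metis prod_decode_inverse surj_pair)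
    let ?F = "{e \<in> E. u \<in> e \<and> rk u e div D = i}"
    have "{e \<in> ?E. w \<in> e} = g ` ?F"
      unfolding w by (auto simp: g_def)
    then have "G.deg w \<le> card ?F"
      unfolding G.deg_def using finite_E by (simp add: card_image_le)
    \<comment> \<open>Edges at \<open>u\<close> have distinct ranks, and those given to copy
      \<open>i\<close> have ranks in the \<open>i\<close>-th block of length
      \<open>D\<close>.\<close>
    also have "card ?F \<le> card {i * D..<i * D + D}"
    proof (rule card_inj_on_le[of "rk u"])
      have "rk u e < rk u f" if "e \<in> ?F" "\<tau> e < \<tau> f" for e f
        unfolding rk_def using that finite_E by (intro psubset_card_mono) auto
      then show "inj_on (rk u) ?F"
        by (smt (verit, best) inj_onI less_irrefl linorder_neqE_nat mem_Collect_eq time_eq_iff)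
      show "rk u ` ?F \<subseteq> {i * D..<i * D + D}"
        using D dividend_less_div_times[of D] by (auto simp: add.commute)
    qed simp
    finally show ?thesis by simp
  qed
  have "card ?V = (\<Sum>u\<in>V. Suc (deg u div D))"
    using finite_V by (subst card_image[OF inj_on_subset[OF inj_prod_encode subset_UNIV]]) simp
  then have "D * card ?V = (\<Sum>u\<in>V. D + D * (deg u div D))"
    by (simp add: sum_distrib_left)
  also have "\<dots> \<le> (\<Sum>u\<in>V. D + deg u)"
    by (intro sum_mono) simp
  also have "\<dots> = D * card V + 2 * card E"
    by (simp add: sum.distrib sum_edges)
  finally have "D * card ?V \<le> D * card V + 2 * card E" .
  moreover have "card ?E = card E"
    using inj_g by (simp add: card_image inj_on_subset)
  ultimately show thesis
    using that[of ?V ?E ?\<tau>] G.timed_graph_axioms deg_le by simp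
qed

text \<open>A counterexample is split to bound its degrees and then bisected. Each part has at most
  \<open>9/16 * n\<close> vertices, hence by induction at most \<open>27/64 * m\<close> edges, since
  \<open>27/64\<close> is \<open>9/16\<close> to the power \<open>3/2\<close>. With the lost edges
  this gives \<open>27/32 + 21/160 = 39/40\<close> of \<open>m\<close>, a contradiction.\<close>

theorem timed_graph_card_E_le:
  fixes V :: "nat set"
  assumes "timed_graph V E \<tau>"
  shows "real (card E) \<le> 10 ^ 5 * (card V * sqrt (card V))"
  using assms
proof (induction "card V" arbitrary: V E \<tau> rule: less_induct)
  case less
  interpret timed_graph V E \<tau> by fact
  define n m where "n = real (card V)" and "m = real (card E)"
  show ?case
  proof (rule ccontr)
    assume "\<not> ?thesis"
    then have m: "10 ^ 5 * (n * sqrt n) < m"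
      by (simp add: n_def m_def)
    have "m \<le> n * n"
      using card_E_le by (simp add: n_def m_def flip: of_nat_mult)
    have "n \<ge> 0" by (simp add: n_def)
    moreover have "n \<noteq> 0"
      using m \<open>m \<le> n * n\<close> by auto
    ultimately have n: "n > 0" by simp
    have "n * (10 ^ 5 * sqrt n) < n * n"
      using m \<open>m \<le> n * n\<close> by (simp add: algebra_simps)
    then have "10 ^ 5 * sqrt n < n"
      using n by simp
    then have "10 ^ 5 * sqrt n < sqrt n * sqrt n"
      using n by simp
    then have sqrt_n: "sqrt n > 10 ^ 5"
      using n by (simp only: mult_less_cancel_right) simp
    \<comment> \<open>Any \<open>n\<close> from 160 on lets \<open>n / 80\<close> absorb the
      additive 2 in the size of \<open>U1\<close>; 13 is the first integer whose square is that
      large.\<close>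
    then have "sqrt n \<ge> 13" by simp
    then have "sqrt n * sqrt n \<ge> 13 * 13"
      using n by (intro mult_mono) auto
    then have n_ge: "n \<ge> 169" using n by simp
    have "n * 1 \<le> n * (10 ^ 5 * sqrt n)"
      using n sqrt_n by (intro mult_left_mono) auto
    then have mn: "n \<le> m" using m by (simp add: algebra_simps)
    have m2: "10 ^ 10 * n ^ 3 \<le> m ^ 2"
    proof -
      have "(10 ^ 5 * (n * sqrt n)) ^ 2 \<le> m ^ 2"
        using m n by (intro power_mono) auto
      also have "(10 ^ 5 * (n * sqrt n)) ^ 2 = 10 ^ 10 * n ^ 3"
        using n by (simp add: power_mult_distrib power2_eq_square power3_eq_cube)
      finally show ?thesis .
    qed
    \<comment> \<open>About twenty times the average degree \<open>2 * m / n\<close>: splitting then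
      adds at most \<open>n / 20\<close> vertices, while degrees stay
      O(\<open>m / n\<close>).\<close>
    define D where "D = nat \<lceil>40 * m / n\<rceil>"
    have "40 * m / n \<ge> 40" using mn n by (simp add: field_simps)
    then have D_ge: "40 * m / n \<le> D" and "real D \<le> 40 * m / n + 1"
      unfolding D_def by linarith+
    moreover have "1 \<le> m / n" using mn n by simp
    ultimately have D_le: "real D \<le> 41 * m / n" by linarith
    have "real D > 0" using D_ge \<open>40 * m / n \<ge> 40\<close> by linarith
    then have "D > 0" by simp
    then obtain V' E' \<tau>' where G': "timed_graph (V' :: nat set) E' \<tau>'" and E': "card E' = card E"
      and deg': "\<And>w. timed_graph.deg E' w \<le> D" and V': "D * card V' \<le> D * card V + 2 * card E"
      by (rule split_vertices[OF timed_graph_axioms]) (rule that; assumption)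
    interpret G: timed_graph V' E' \<tau>' by fact
    define N where "N = real (card V')"
    have "real D * N \<le> D * n + 2 * m"
      using V' unfolding N_def n_def m_def by (metis of_nat_add of_nat_le_iff of_nat_mult of_nat_numeral)
    also have "2 * m \<le> D * (n / 20)"
      using D_ge n by (simp add: field_simps)
    finally have "real D * N \<le> D * (21 / 20 * n)"
      by (simp add: algebra_simps)
    then have N_le: "N \<le> 21 / 20 * n"
      using \<open>real D > 0\<close> by simp
    \<comment> \<open>Small enough that the \<open>s * N\<close> lost edges are at most
      \<open>21/160\<close> of \<open>m\<close>, yet a fixed fraction of the average degree.\<close>
    define s where "s = m / (8 * n)"
    have s: "s > 0" using n mn by (simp add: s_def)
    obtain U1 U2 \<theta> where U: "U1 \<subseteq> V'" "U2 \<subseteq> V'"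
      "real (card E') \<le> card {e \<in> E'. e \<subseteq> U1} + card {e \<in> E'. e \<subseteq> U2} + s * card V'"
      "real (card U1) \<le> card V' / 2 + 2 + card {w \<in> V'. s < G.deg_lo \<theta> w \<and> s < G.deg_hi \<theta> w}"
      "real (card U2) \<le> card V' / 2"
      by (rule G.bisection[OF less_imp_le[OF s]]) (rule that; assumption)
    define M where "M = {w \<in> V'. s < G.deg_lo \<theta> w \<and> s < G.deg_hi \<theta> w}"
    define \<mu> where "\<mu> = real (card M)"
    \<comment> \<open>Every vertex of \<open>M\<close> contributes at least \<open>s * s\<close> to
      the sum bounded by \<open>sum_deg_lo_hi\<close>; this limits the duplicated vertices.\<close>
    have "\<mu> * (s * s) \<le> (\<Sum>w\<in>M. real (G.deg_lo \<theta> w) * real (G.deg_hi \<theta> w))"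
      unfolding \<mu>_def using s by (intro sum_bounded_below mult_mono) (auto simp: M_def)
    also have "\<dots> \<le> (\<Sum>w\<in>V'. real (G.deg_lo \<theta> w) * real (G.deg_hi \<theta> w))"
      using G.finite_V by (intro sum_mono2) (auto simp: M_def)
    finally have "(\<mu> * (s * s))\<^sup>2 \<le> (\<Sum>w\<in>V'. real (G.deg_lo \<theta> w) * real (G.deg_hi \<theta> w))\<^sup>2"
      by (intro power_mono) (auto simp: \<mu>_def)
    also have "\<dots> \<le> 6 * N\<^sup>2 * (\<Sum>w\<in>V'. real (G.deg w) ^ 2)"
      unfolding N_def by (rule G.sum_deg_lo_hi)
    also have "\<dots> \<le> 6 * (21 / 20 * n)\<^sup>2 * (82 * m\<^sup>2 / n)"
    proof (rule mult_mono)
      show "6 * N\<^sup>2 \<le> 6 * (21 / 20 * n)\<^sup>2"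
        using N_le by (intro mult_left_mono power_mono) (auto simp: N_def)
      have "(\<Sum>w\<in>V'. real (G.deg w) ^ 2) \<le> (\<Sum>w\<in>V'. real D * real (G.deg w))"
        using deg' by (intro sum_mono) (simp add: power2_eq_square mult_right_mono)
      also have "\<dots> = real D * (\<Sum>w\<in>V'. G.deg w)"
        by (simp add: sum_distrib_left)
      also have "\<dots> = D * (2 * m)"
        unfolding G.sum_edges E' m_def by simp
      also have "\<dots> \<le> 41 * m / n * (2 * m)"
        using D_le mn n by (intro mult_right_mono) auto
      finally show "(\<Sum>w\<in>V'. real (G.deg w) ^ 2) \<le> 82 * m\<^sup>2 / n"
        by (simp add: power2_eq_square)
    qed (auto intro: sum_nonneg)
    also have "\<dots> = 542430 / 1000 * (n * m\<^sup>2)"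
      using n by (simp add: power2_eq_square field_simps)
    also have "\<dots> \<le> 543 * n * m\<^sup>2"
      using n by simp
    also have "(\<mu> * (s * s))\<^sup>2 = \<mu>\<^sup>2 * m\<^sup>2 * m\<^sup>2 / (4096 * n ^ 4)"
      by (simp add: s_def power2_eq_square power4_eq_xxxx mult_ac)
    finally have "\<mu>\<^sup>2 * m\<^sup>2 * m\<^sup>2 \<le> 543 * n * m\<^sup>2 * (4096 * n ^ 4)"
      using n by (simp add: pos_divide_le_eq)
    then have "(\<mu>\<^sup>2 * m\<^sup>2) * m\<^sup>2 \<le> (543 * 4096 * n ^ 5) * m\<^sup>2"
      by (simp add: eval_nat_numeral algebra_simps)
    then have "\<mu>\<^sup>2 * m\<^sup>2 \<le> 543 * 4096 * n ^ 5"
      using mn n by (simp only: mult_le_cancel_right) auto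
    \<comment> \<open>Here the assumed density enters: the factor \<open>10 ^ 10\<close> of
      \<open>m2\<close> pushes \<mu> below \<open>n / 40\<close>.\<close>
    moreover have "\<mu>\<^sup>2 * (10 ^ 10 * n ^ 3) \<le> \<mu>\<^sup>2 * m\<^sup>2"
      using m2 by (intro mult_left_mono) auto
    ultimately have "(\<mu>\<^sup>2 * 10 ^ 10) * n ^ 3 \<le> (543 * 4096 * n ^ 2) * n ^ 3"
      by (simp add: eval_nat_numeral algebra_simps)
    then have "\<mu>\<^sup>2 * 10 ^ 10 \<le> 543 * 4096 * n ^ 2"
      using n by (simp only: mult_le_cancel_right) auto
    then have "9765625 * \<mu>\<^sup>2 \<le> 2172 * n\<^sup>2"
      by simp
    moreover have "(n / 40)\<^sup>2 = n\<^sup>2 / 1600"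
      by (simp add: power_divide)
    ultimately have "\<mu>\<^sup>2 \<le> (n / 40)\<^sup>2"
      using zero_le_power2[of n] by linarith
    then have \<mu>: "\<mu> \<le> n / 40"
      by (rule power2_le_imp_le) (use n in simp)
    have cU: "real (card U) \<le> 9 / 16 * n" if "U = U1 \<or> U = U2" for U
      using that U(4,5) \<mu> n_ge N_le unfolding \<mu>_def M_def N_def by auto
    have IH: "real (card {e \<in> E'. e \<subseteq> U}) \<le> 27 / 64 * m" if U': "U = U1 \<or> U = U2" for U
    proof -
      have "real (card U) < n" using cU[OF U'] n by linarith
      then have "card U < card V" by (simp add: n_def)
      moreover have "timed_graph U {e \<in> E'. e \<subseteq> U} \<tau>'"
        using U U' by (intro G.induced) auto
      ultimately have "real (card {e \<in> E'. e \<subseteq> U}) \<le> 10 ^ 5 * (card U * sqrt (card U))"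
        by (rule less.hyps)
      also have "\<dots> \<le> 10 ^ 5 * ((9 / 16 * n) * sqrt (9 / 16 * n))"
        using cU[OF U'] n by (intro mult_left_mono mult_mono real_sqrt_le_mono) auto
      also have "sqrt (9 / 16 * n) = 3 / 4 * sqrt n"
        by (simp add: real_sqrt_mult real_sqrt_divide)
      also have "10 ^ 5 * ((9 / 16 * n) * (3 / 4 * sqrt n)) = 27 / 64 * (10 ^ 5 * (n * sqrt n))"
        by simp
      also have "\<dots> \<le> 27 / 64 * m" using m by simp
      finally show ?thesis .
    qed
    have "s * N \<le> s * (21 / 20 * n)"
      using N_le s by (intro mult_left_mono) auto
    also have "\<dots> = 21 / 160 * m"
      using n by (simp add: s_def)
    finally have "s * N \<le> 21 / 160 * m" .
    then have "m \<le> 27 / 64 * m + 27 / 64 * m + 21 / 160 * m"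
      using U(3) IH[OF disjI1[OF refl]] IH[OF disjI2[OF refl]] unfolding E' N_def m_def by linarith
    then show False using mn n by simp
  qed
qed

section \<open>Transfer to edge-ordered graphs\<close>

lemma nth_list_order_iff:
  assumes "distinct xs" "i < length xs" "j < length xs"
  shows "(xs ! i, xs ! j) \<in> list_order xs \<longleftrightarrow> i \<le> j"
  using assms by (auto simp: list_order_def nth_eq_iff_index_eq)

lemma linear_order_on_Restr:
  assumes "linear_order_on A r" "B \<subseteq> A"
  shows "linear_order_on B (Restr r B)"
  using assms unfolding linear_order_on_def partial_order_on_def preorder_on_def
  by (auto simp: refl_on_def total_on_def antisym_def trans_def subset_iff)

text \<open>Both orders are compared through positions in the lists \<open>xs\<close> and
  \<open>ys\<close>. Transitivity extends the three given comparisons to all pairs, and antisymmetry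
  excludes the reverse ones.\<close>

lemma eo_contains_C4_1243I:
  assumes G: "edge_ordered_graph G"
    and E: "{a, b} \<in> edges G" "{b, c} \<in> edges G" "{d, a} \<in> edges G" "{c, d} \<in> edges G"
    and ne: "a \<noteq> c" "b \<noteq> d"
    and less: "({a, b}, {b, c}) \<in> eord G" "({b, c}, {d, a}) \<in> eord G" "({d, a}, {c, d}) \<in> eord G"
  shows "eo_contains G C4_1243"
proof -
  have card2: "card e = 2" and sub: "e \<subseteq> verts G" if "e \<in> edges G" for e
    using G that by (auto simp: edge_ordered_graph_def)
  have lin: "linear_order_on (edges G) (eord G)"
    using G by (simp add: edge_ordered_graph_def)
  have ne': "a \<noteq> b" "b \<noteq> c" "d \<noteq> a" "c \<noteq> d"
    using E card2 by fastforce+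
  define xs where "xs = [{0, 1}, {1, 2}, {3, 0}, {2, 3 :: nat}]"
  define ys where "ys = [{a, b}, {b, c}, {d, a}, {c, d}]"
  define f :: "nat \<Rightarrow> 'a" where "f i = [a, b, c, d] ! i" for i
  have f: "f 0 = a" "f 1 = b" "f 2 = c" "f 3 = d"
    by (simp_all add: f_def)
  have ys: "ys = map ((`) f) xs"
    unfolding xs_def ys_def by (simp add: f[simplified])
  have dist: "distinct xs" "distinct ys"
    using ne ne' by (auto simp: xs_def ys_def doubleton_eq_iff)
  have set_xs: "set xs = edges C4_1243"
    by (auto simp: xs_def C4_1243_def)
  have set_ys: "set ys \<subseteq> edges G"
    using E by (simp add: ys_def)
  have len: "length ys = 4" "length xs = 4"
    by (simp_all add: xs_def ys_def)
  have tr: "trans (eord G)" and anti: "antisym (eord G)" and re: "refl_on (edges G) (eord G)"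
    using lin by (auto simp: linear_order_on_def partial_order_on_def preorder_on_def)
  have "sorted_wrt (\<lambda>e f. (e, f) \<in> eord G) ys"
    using less transD[OF tr less(1,2)] transD[OF tr less(2,3)]
      transD[OF tr transD[OF tr less(1,2)] less(3)] by (simp add: ys_def)
  then have le: "(ys ! i, ys ! j) \<in> eord G" if "i \<le> j" "j < 4" for i j
  proof (cases "i = j")
    case True
    have "ys ! j \<in> edges G"
      using that len set_ys nth_mem[of j ys] by auto
    then show ?thesis
      using True refl_onD[OF re] by simp
  next
    case False
    then show ?thesis
      using that len \<open>sorted_wrt _ ys\<close> by (simp add: sorted_wrt_iff_nth_less)
  qed
  have ord: "(ys ! i, ys ! j) \<in> eord G \<longleftrightarrow> i \<le> j" if "i < 4" "j < 4" for i j
  proof (cases "i \<le> j")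
    case False
    then have "(ys ! j, ys ! i) \<in> eord G" "ys ! i \<noteq> ys ! j"
      using le that dist len by (auto simp: nth_eq_iff_index_eq)
    then show ?thesis
      using False anti by (auto dest: antisymD)
  qed (use le that in auto)
  define G' where "G' = \<lparr>verts = {a, b, c, d}, edges = set ys, eord = Restr (eord G) (set ys)\<rparr>"
  have "edge_ordered_graph G'"
    using ne' linear_order_on_Restr[OF lin set_ys]
    by (auto simp: edge_ordered_graph_def G'_def ys_def)
  moreover have "{a, b, c, d} \<subseteq> verts G"
    using E sub by blast
  ultimately have "eo_subgraph G' G"
    using set_ys by (simp add: eo_subgraph_def G'_def)
  moreover have "eo_isomorphic C4_1243 G'"
    unfolding eo_isomorphic_def
  proof (intro exI[of _ f] conjI ballI)
    show "bij_betw f (verts C4_1243) (verts G')"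
      using ne ne' f[simplified] by (simp add: bij_betw_def inj_on_def C4_1243_def G'_def)
    show "(`) f ` edges C4_1243 = edges G'"
      by (simp add: G'_def ys set_xs[symmetric])
    fix e e' assume "e \<in> edges C4_1243" "e' \<in> edges C4_1243"
    then obtain i j where ij: "i < 4" "j < 4" "e = xs ! i" "e' = xs ! j"
      unfolding set_xs[symmetric] in_set_conv_nth len by blast
    have "(e, e') \<in> eord C4_1243 \<longleftrightarrow> i \<le> j"
      using nth_list_order_iff[OF dist(1)] ij len by (simp add: C4_1243_def xs_def)
    also have "\<dots> \<longleftrightarrow> (ys ! i, ys ! j) \<in> eord G'"
      using ord ij len by (simp add: G'_def)
    finally show "(e, e') \<in> eord C4_1243 \<longleftrightarrow> (f ` e, f ` e') \<in> eord G'"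
      using ij len by (simp add: ys)
  qed
  ultimately show ?thesis
    unfolding eo_contains_def by blast
qed

text \<open>The time of an edge is its rank in the linear order, which grows strictly along the
  order.\<close>

lemma timed_graph_of_avoiding:
  assumes G: "edge_ordered_graph G" and avoids: "eo_avoids G C4_1243"
  defines "\<tau> \<equiv> \<lambda>e. card {f \<in> edges G. (f, e) \<in> eord G}"
  shows "timed_graph (verts G) (edges G) \<tau>"
proof -
  have fin: "finite (verts G)" and edge: "\<And>e. e \<in> edges G \<Longrightarrow> e \<subseteq> verts G \<and> card e = 2"
    and lin: "linear_order_on (edges G) (eord G)"
    using G by (auto simp: edge_ordered_graph_def)
  have finE: "finite (edges G)"
    by (rule finite_subset[of _ "Pow (verts G)"]) (use edge fin in auto)
  have tr: "trans (eord G)" and anti: "antisym (eord G)" and re: "refl_on (edges G) (eord G)"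
    and tot: "total_on (edges G) (eord G)"
    using lin by (auto simp: linear_order_on_def partial_order_on_def preorder_on_def)
  have strict: "\<tau> f < \<tau> e" if "e \<in> edges G" "f \<in> edges G" "(e, f) \<notin> eord G" for e f
  proof -
    have "(f, e) \<in> eord G"
      using that re tot unfolding total_on_def by (metis refl_onD)
    then have "{g \<in> edges G. (g, f) \<in> eord G} \<subset> {g \<in> edges G. (g, e) \<in> eord G}"
      using that re tr by (auto dest: transD refl_onD)
    then show ?thesis
      unfolding \<tau>_def using finE by (intro psubset_card_mono) auto
  qed
  have inj: "inj_on \<tau> (edges G)"
  proof (rule inj_onI)
    fix e f assume "e \<in> edges G" "f \<in> edges G" "\<tau> e = \<tau> f"
    then have "(e, f) \<in> eord G" "(f, e) \<in> eord G"
      using strict[of e f] strict[of f e] by auto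
    then show "e = f" using anti by (auto dest: antisymD)
  qed
  show ?thesis
  proof
    fix a b c d assume E: "{a, b} \<in> edges G" "{b, c} \<in> edges G" "{a, d} \<in> edges G" "{c, d} \<in> edges G"
      and less: "\<tau> {a, b} < \<tau> {b, c}" "\<tau> {b, c} < \<tau> {a, d}" "\<tau> {a, d} < \<tau> {c, d}"
    have "({a, b}, {b, c}) \<in> eord G" "({b, c}, {a, d}) \<in> eord G" "({a, d}, {c, d}) \<in> eord G"
      using strict E less by (meson less_asym)+
    moreover have "a \<noteq> c" "b \<noteq> d"
      using less by (auto simp: insert_commute)
    ultimately have "eo_contains G C4_1243"
      using E by (intro eo_contains_C4_1243I[OF G, of a b c d]) (simp_all add: insert_commute)
    with avoids show False by blast
  qed (use fin edge inj in auto)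
qed

lemma ex_eo_C4_1243_le: "real (ex_eo n C4_1243) \<le> 10 ^ 5 * (n * sqrt n)"
proof -
  have "edges C4_1243 \<noteq> {}" by (simp add: C4_1243_def)
  from ex_eo_attained(1)[OF this, of n] obtain G :: "nat eo_graph" where
    G: "edge_ordered_graph G" "card (verts G) = n" "eo_avoids G C4_1243" "card (edges G) = ex_eo n C4_1243"
    by blast
  show ?thesis
    using timed_graph_card_E_le[OF timed_graph_of_avoiding[OF G(1,3)]] G(2,4) by simp
qed

lemma powr_three_halves: "real n powr (3 / 2) = n * sqrt n"
proof (cases "n = 0")
  case False
  have "real n powr (1 + 1 / 2) = real n powr 1 * real n powr (1 / 2)"
    by (rule powr_add)
  then show ?thesis using False by (simp add: powr_half_sqrt)
qed simp

section \<open>The lower bound\<close>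

lemma two_eq_0_alg_closure_bit: "(2 :: bit alg_closure) = 0"
  using to_ac_numeral[of "num.Bit0 num.One", where 'a = bit] by simp

lemma frobenius_add:
  fixes x y :: "'a :: comm_ring_1"
  assumes "(2 :: 'a) = 0"
  shows "(x + y) ^ 2 ^ k = x ^ 2 ^ k + y ^ 2 ^ k"
proof (induction k)
  case (Suc k)
  have "(x + y) ^ 2 ^ Suc k = ((x + y) ^ 2 ^ k)\<^sup>2"
    by (simp add: mult.commute[of 2] power_mult)
  also have "\<dots> = (x ^ 2 ^ k)\<^sup>2 + (y ^ 2 ^ k)\<^sup>2"
    by (simp add: Suc power2_sum assms)
  finally show ?case
    by (simp add: mult.commute[of 2] power_mult)
qed simp

text \<open>The polynomial splits into linear factors, and a repeated factor would give a common
  root with the derivative.\<close>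

lemma card_roots_separable:
  fixes p :: "'a :: alg_closed_field poly"
  assumes "p \<noteq> 0" and simple: "\<And>x. poly p x = 0 \<Longrightarrow> poly (pderiv p) x \<noteq> 0"
  shows "card {x. poly p x = 0} = degree p"
proof -
  obtain A where A: "size A = degree p" "p = smult (lead_coeff p) (\<Prod>x\<in>#A. [:-x, 1:])"
    using alg_closed_imp_factorization \<open>p \<noteq> 0\<close> by blast
  have "proots p = proots (\<Prod>x\<in>#A. [:-x, 1:])"
    using \<open>p \<noteq> 0\<close> by (subst A(2)) simp
  also have "proots (\<Prod>x\<in>#A. [:-x, 1:]) = A" for A :: "'a multiset"
  proof (induction A)
    case (add x A)
    have "(\<Prod>x\<in>#A. [:-x, 1:]) \<noteq> 0" by (auto simp: prod_mset_zero_iff)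
    then show ?case using add by (simp add: proots_mult del: mult_pCons_left)
  qed simp
  finally have "proots p = A" .
  have "count A x \<le> 1" for x
  proof (rule ccontr)
    assume "\<not> count A x \<le> 1"
    then have "2 \<le> order x p"
      using \<open>p \<noteq> 0\<close> \<open>proots p = A\<close> by (metis count_proots not_less_eq_eq numeral_2_eq_2 One_nat_def)
    then have "[:-x, 1:] ^ 2 dvd p"
      by (simp add: order_divides)
    then obtain q where "p = [:-x, 1:] ^ 2 * q" by (elim dvdE)
    then have "poly p x = 0" "poly (pderiv p) x = 0"
      by (simp_all add: power2_eq_square pderiv_mult del: mult_pCons_left mult_pCons_right)
    with simple show False by blast
  qed
  then have "count A x = 1" if "x \<in># A" for x
    using that count_greater_zero_iff[of A x] by (metis One_nat_def Suc_leI le_antisym)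
  then have "size A = card (set_mset A)"
    by (simp add: size_multiset_overloaded_eq)
  then show ?thesis
    using A \<open>proots p = A\<close> \<open>p \<noteq> 0\<close> by (metis set_count_proots)
qed

text \<open>For positive \<open>k\<close> these are the roots of \<open>x ^ 2 ^ k - x\<close>, whose
  derivative is constant and nonzero. Closure under addition is \<open>frobenius_add\<close>.
  Subtraction and cancellation can later be done in the surrounding field.\<close>

lemma finite_field_two_power:
  obtains K :: "bit alg_closure set" where "card K = 2 ^ k"
    "\<And>x y. x \<in> K \<Longrightarrow> y \<in> K \<Longrightarrow> x + y \<in> K" "\<And>x y. x \<in> K \<Longrightarrow> y \<in> K \<Longrightarrow> x * y \<in> K"
proof (cases k)
  \<comment> \<open>The polynomial would be zero here, but one element closed under both operations
    is all that is asked for.\<close>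
  case 0
  show thesis
    by (rule that[of "{0}"]) (auto simp: 0)
next
  case (Suc j)
  define p :: "bit alg_closure poly" where "p = monom 1 (2 ^ k) - monom 1 1"
  let ?K = "{x :: bit alg_closure. x ^ 2 ^ k = x}"
  have "(1 :: nat) < 2 ^ k" using Suc by (intro one_less_power) auto
  then have deg: "degree p = 2 ^ k"
    unfolding p_def diff_conv_add_uminus by (subst degree_add_eq_left) (auto simp: degree_monom_eq)
  have "pderiv p = - 1"
    by (simp add: p_def pderiv_diff pderiv_monom Suc two_eq_0_alg_closure_bit one_pCons monom_0)
  moreover have "p \<noteq> 0"
    using deg by (metis degree_0 power_eq_0_iff zero_neq_numeral)
  ultimately have "card {x. poly p x = 0} = 2 ^ k"
    by (simp add: card_roots_separable deg)
  then have "card ?K = 2 ^ k"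
    by (simp add: p_def poly_monom)
  then show thesis
    by (rule that[of ?K]) (simp_all add: frobenius_add two_eq_0_alg_closure_bit power_mult_distrib)
qed

section \<open>The point-line incidence graph\<close>

lemma eo_contains_C4_1243_cycle:
  assumes "eo_contains G C4_1243"
  obtains a b c d where "{a, b} \<in> edges G" "{b, c} \<in> edges G" "{c, d} \<in> edges G" "{d, a} \<in> edges G"
    "a \<noteq> c" "b \<noteq> d"
proof -
  obtain G' where G': "eo_subgraph G' G" "eo_isomorphic C4_1243 G'"
    using assms unfolding eo_contains_def by blast
  obtain f where f: "bij_betw f (verts C4_1243) (verts G')" "(\<lambda>e. f ` e) ` edges C4_1243 = edges G'"
    using G'(2) unfolding eo_isomorphic_def by blast
  have "edges G' \<subseteq> edges G"
    using G' by (simp add: eo_subgraph_def)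
  then have "{{f 0, f 1}, {f 1, f 2}, {f 2, f 3}, {f 3, f 0}} \<subseteq> edges G"
    using f(2) by (simp add: C4_1243_def)
  moreover have "inj_on f {0, 1, 2, 3}"
    using f by (simp add: bij_betw_def C4_1243_def)
  then have "f 0 \<noteq> f 2" "f 1 \<noteq> f 3"
    by (simp_all add: inj_on_eq_iff)
  ultimately show thesis
    by (intro that[of "f 0" "f 1" "f 2" "f 3"]) simp_all
qed

text \<open>There are \<open>4 ^ k\<close> points and as many lines; an edge is a point with the
  slope of a line through it, which gives \<open>8 ^ k\<close> edges. Remaining vertices are
  isolated.\<close>

lemma dense_C4_free_graph:
  assumes n: "2 * 4 ^ k \<le> n"
  obtains E :: "nat set set" where "\<And>e. e \<in> E \<Longrightarrow> e \<subseteq> {..<n} \<and> card e = 2" "card E = 8 ^ k"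
    "\<And>a b c d. \<lbrakk>{a, b} \<in> E; {b, c} \<in> E; {c, d} \<in> E; {d, a} \<in> E\<rbrakk> \<Longrightarrow> a = c \<or> b = d"
proof -
  obtain K :: "bit alg_closure set" where K: "card K = 2 ^ k"
    "\<And>x y. x \<in> K \<Longrightarrow> y \<in> K \<Longrightarrow> x + y \<in> K" "\<And>x y. x \<in> K \<Longrightarrow> y \<in> K \<Longrightarrow> x * y \<in> K"
    using finite_field_two_power by blast
  then have fin: "finite K"
    by (metis card.infinite power_eq_0_iff zero_neq_numeral)
  let ?A = "K \<times> K \<times> (UNIV :: bool set)"
  have "card ?A = 2 * 4 ^ k"
    using K(1) by (simp add: card_cartesian_product flip: power_mult_distrib)
  then have "\<exists>h. h ` ?A \<subseteq> {..<n} \<and> inj_on h ?A"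
    using n fin inj_on_iff_card_le[of ?A "{..<n}"] by auto
  then obtain h where h: "h ` ?A \<subseteq> {..<n}" "inj_on h ?A" by blast
  \<comment> \<open>The point \<open>(x, y)\<close> lies on the line \<open>(m, b)\<close> if \<open>y + m x = b\<close>.\<close>
  define g where "g = (\<lambda>(x, y, m). {h (x, y, False), h (m, y + m * x, True)})"
  define E where "E = g ` (K \<times> K \<times> K)"
  have eq: "h (x, y, t) = h (x', y', t') \<longleftrightarrow> x = x' \<and> y = y' \<and> t = t'"
    if "x \<in> K" "y \<in> K" "x' \<in> K" "y' \<in> K" for x y t x' y' t'
    using inj_on_eq_iff[OF h(2), of "(x, y, t)" "(x', y', t')"] that by auto
  define inc where "inc a b \<longleftrightarrow> (\<exists>x\<in>K. \<exists>y\<in>K. \<exists>m\<in>K. a = h (x, y, False) \<and> b = h (m, y + m * x, True))" for a b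
  have inc: "inc a b \<or> inc b a" if "{a, b} \<in> E" for a b
    using that by (fastforce simp: E_def g_def inc_def doubleton_eq_iff)
  have bip: "\<not> inc c a" if "inc a b" for a b c
    using that K eq by (auto simp: inc_def)
  \<comment> \<open>Two points on two common lines: subtracting the equations gives
    \<open>(m - m') * (x - x') = 0\<close>. Equal slopes make the lines equal, and equal
    \<open>x\<close> make the points equal.\<close>
  have unique: "a = c \<or> b = d" if "inc a b" "inc c b" "inc c d" "inc a d" for a b c d
  proof -
    obtain x y m where 1: "x \<in> K" "y \<in> K" "m \<in> K" "a = h (x, y, False)" "b = h (m, y + m * x, True)"
      using \<open>inc a b\<close> unfolding inc_def by blast
    obtain x' y' m' where 2: "x' \<in> K" "y' \<in> K" "m' \<in> K" "c = h (x', y', False)" "d = h (m', y' + m' * x', True)"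
      using \<open>inc c d\<close> unfolding inc_def by blast
    have "y + m * x = y' + m * x'"
      using \<open>inc c b\<close> 1 2 K eq unfolding inc_def by auto
    moreover have "y + m' * x = y' + m' * x'"
      using \<open>inc a d\<close> 1 2 K eq unfolding inc_def by auto
    moreover have "(m - m') * (x - x') = (y + m * x - (y' + m * x')) - (y + m' * x - (y' + m' * x'))"
      by (simp add: algebra_simps)
    ultimately have "(m - m') * (x - x') = 0"
      by simp
    then have "m = m' \<or> x = x'" by simp
    then show ?thesis
      using \<open>y + m * x = y' + m * x'\<close> 1 2 by auto
  qed
  show thesis
  proof (rule that[of E])
    show "e \<subseteq> {..<n} \<and> card e = 2" if "e \<in> E" for e
    proof -
      obtain x y m where e: "e = g (x, y, m)" "x \<in> K" "y \<in> K" "m \<in> K"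
        using \<open>e \<in> E\<close> unfolding E_def by auto
      then have "h (x, y, False) \<noteq> h (m, y + m * x, True)"
        using K eq by auto
      then show ?thesis
        using e K h(1) by (simp add: g_def image_subset_iff)
    qed
    have "inj_on g (K \<times> K \<times> K)"
      using eq K by (auto simp: inj_on_def g_def doubleton_eq_iff)
    then have "card E = card K * (card K * card K)"
      by (simp add: E_def card_image card_cartesian_product)
    then show "card E = 8 ^ k"
      by (simp add: K flip: power_mult_distrib)
    show "a = c \<or> b = d" if "{a, b} \<in> E" "{b, c} \<in> E" "{c, d} \<in> E" "{d, a} \<in> E" for a b c d
    proof -
      consider "inc a b" | "inc b a" using inc \<open>{a, b} \<in> E\<close> by blast
      then show ?thesis
      proof cases
        case 1
        then have "inc c b" using inc \<open>{b, c} \<in> E\<close> bip by blast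
        then have "inc c d" using inc \<open>{c, d} \<in> E\<close> bip by blast
        then have "inc a d" using inc \<open>{d, a} \<in> E\<close> bip by blast
        show ?thesis by (rule unique) fact+
      next
        case 2
        then have "inc b c" using inc \<open>{b, c} \<in> E\<close> bip by blast
        then have "inc d c" using inc \<open>{c, d} \<in> E\<close> bip by blast
        then have "inc d a" using inc \<open>{d, a} \<in> E\<close> bip by blast
        have "b = d \<or> a = c" by (rule unique) fact+
        then show ?thesis by blast
      qed
    qed
  qed
qed

text \<open>A graph without four-cycles avoids the pattern under every edge order, so an arbitrary
  enumeration of the edges serves.\<close>

lemma ex_eo_C4_1243_ge:
  assumes "2 * 4 ^ k \<le> n"
  shows "8 ^ k \<le> ex_eo n C4_1243"
proof -
  obtain E :: "nat set set" where E: "\<And>e. e \<in> E \<Longrightarrow> e \<subseteq> {..<n} \<and> card e = 2" "card E = 8 ^ k"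
    "\<And>a b c d. \<lbrakk>{a, b} \<in> E; {b, c} \<in> E; {c, d} \<in> E; {d, a} \<in> E\<rbrakk> \<Longrightarrow> a = c \<or> b = d"
    using dense_C4_free_graph[OF assms] by blast
  have "finite E"
    using E(2) by (metis card.infinite power_eq_0_iff zero_neq_numeral)
  then obtain xs where xs: "set xs = E" "distinct xs"
    using finite_distinct_list by blast
  let ?G = "\<lparr>verts = {..<n}, edges = E, eord = list_order xs\<rparr>"
  have "edge_ordered_graph ?G"
    using E(1) linear_order_on_list_order[OF xs(2)] by (simp add: edge_ordered_graph_def xs(1))
  moreover have "eo_avoids ?G C4_1243"
  proof
    assume "eo_contains ?G C4_1243"
    then show False
      by (rule eo_contains_C4_1243_cycle) (use E(3) in auto)
  qed
  ultimately have "card (edges ?G) \<le> ex_eo n C4_1243"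
    by (intro ex_eo_attained(2)) (auto simp: C4_1243_def)
  then show ?thesis by (simp add: E(2))
qed

theorem theorem1p14:
  shows "\<exists>c1 c2 :: real. \<exists>n0 :: nat. c1 > 0 \<and> c2 > 0 \<and>
    (\<forall>n\<ge>n0. c1 * real n powr (3 / 2) \<le> real (ex_eo n C4_1243) \<and>
             real (ex_eo n C4_1243) \<le> c2 * real n powr (3 / 2))"
proof (intro exI conjI allI impI)
  \<comment> \<open>With \<open>k\<close> the largest exponent such that
    \<open>2 * 4 ^ k \<le> n\<close>, the bounds \<open>n \<le> 8 * 4 ^ k\<close> and
    \<open>sqrt n \<le> 3 * 2 ^ k\<close> multiply to \<open>24 * 8 ^ k\<close>.\<close>
  show "(1 / 24 :: real) > 0" "(10 ^ 5 :: real) > 0" by simp_all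
  fix n :: nat assume "2 \<le> n"
  then have "1 \<le> n div 2" by simp
  then obtain k where "4 ^ k \<le> n div 2" "n div 2 < 4 ^ (k + 1)"
    using ex_power_ivl1[of 4 "n div 2"] by auto
  then have k: "2 * 4 ^ k \<le> n" "n \<le> 8 * 4 ^ k"
    by simp_all
  have n_le: "real n \<le> 8 * 4 ^ k"
    using k(2) by (metis of_nat_le_iff of_nat_mult of_nat_numeral of_nat_power)
  moreover have "(3 * 2 ^ k)\<^sup>2 = (9 * 4 ^ k :: real)"
    by (simp add: power2_eq_square flip: power_mult_distrib)
  ultimately have "sqrt n \<le> 3 * 2 ^ k"
    by (intro real_le_lsqrt) auto
  then have "n * sqrt n \<le> (8 * 4 ^ k) * (3 * 2 ^ k)"
    using n_le by (intro mult_mono) auto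
  also have "\<dots> = 24 * 8 ^ k"
    by (simp flip: power_mult_distrib)
  also have "(8 :: real) ^ k \<le> ex_eo n C4_1243"
    using ex_eo_C4_1243_ge[OF k(1)] by (metis of_nat_le_iff of_nat_numeral of_nat_power)
  finally show "1 / 24 * real n powr (3 / 2) \<le> real (ex_eo n C4_1243)"
    by (simp add: powr_three_halves)
  show "real (ex_eo n C4_1243) \<le> 10 ^ 5 * real n powr (3 / 2)"
    using ex_eo_C4_1243_le by (simp add: powr_three_halves)
qed

end
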